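(* Let $d\ge 1$ be an integer and let $G_1,\dots,G_r$ be all the connected graphs (up to isomorphism) having between $1$ and $d$ edges. Then there exist finite simple graphs $T$ and $U$, each with at most $(d+1)(2^d-1)$ edges, which are not isomorphic (even after discarding isolated vertices) and which cannot be separated by $I(G_1),\dots,I(G_r)$, i.e. $I(G_i)(T)=I(G_i)(U)$ for all $i=1,\dots,r$.
   Context: All graphs are finite simple graphs (undirected, no loops, no multiple edges), considered up to isomorphism and up to adding or deleting isolated vertices. For graphs $G,H$, $I(G)(H)$ denotes the number of subsets $F$ of the edge set of $H$ such that the graph formed by the edges in $F$ (together with their endpoints) is isomorphic to $G$ (ignoring isolated vertices of $G$). The degree of a graph is its number of edges. A graph is connected here if it has at least one edge and its edges (with their endpoints) form a connected graph. *)

theory Defs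
  imports Main
begin

datatype 'a graph = Graph (verts: "'a set") (edges: "'a set set")

definition simple_graph :: "'a graph \<Rightarrow> bool" where
  "simple_graph G \<longleftrightarrow> finite (verts G) \<and> (\<forall>e\<in>edges G. e \<subseteq> verts G \<and> card e = 2)"

definition degree :: "'a graph \<Rightarrow> nat" where
  "degree G = card (edges G)"

definition isomorphic :: "'a graph \<Rightarrow> 'b graph \<Rightarrow> bool" where
  "isomorphic G H \<longleftrightarrow>
    (\<exists>f. bij_betw f (verts G) (verts H) \<and> edges H = (\<lambda>e. f ` e) ` edges G)"

text \<open>The graph formed by a set of edges together with their endpoints.\<close>

definition edge_graph :: "'a set set \<Rightarrow> 'a graph" where
  "edge_graph F = Graph (\<Union>F) F"

definition drop_isolated :: "'a graph \<Rightarrow> 'a graph" where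
  "drop_isolated G = edge_graph (edges G)"

definition isomorphic_core :: "'a graph \<Rightarrow> 'b graph \<Rightarrow> bool" where
  "isomorphic_core G H \<longleftrightarrow> isomorphic (drop_isolated G) (drop_isolated H)"

definition connected_graph :: "'a graph \<Rightarrow> bool" where
  "connected_graph G \<longleftrightarrow> edges G \<noteq> {} \<and>
    (\<forall>u\<in>verts (drop_isolated G). \<forall>v\<in>verts (drop_isolated G).
      (u, v) \<in> {(x, y). {x, y} \<in> edges G}\<^sup>*)"

text \<open>The number \<open>I(G)(H)\<close>.\<close>

definition subgraph_count :: "'a graph \<Rightarrow> 'b graph \<Rightarrow> nat" where
  "subgraph_count G H = card {F. F \<subseteq> edges H \<and> isomorphic (drop_isolated G) (edge_graph F)}"

definition connected_upto :: "nat \<Rightarrow> 'a graph \<Rightarrow> bool" where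
  "connected_upto d H \<longleftrightarrow> simple_graph H \<and> connected_graph H \<and> 1 \<le> degree H \<and> degree H \<le> d"

text \<open>
  \<open>G 1, \<dots>, G r\<close> are all graphs satisfying \<^const>\<open>connected_upto\<close>, each isomorphism class (with
  isolated vertices ignored) occurring exactly once. Vertices are natural numbers, which loses
  nothing since every finite graph is isomorphic to one of this kind.
\<close>

definition enumerates_connected :: "nat \<Rightarrow> nat \<Rightarrow> (nat \<Rightarrow> nat graph) \<Rightarrow> bool" where
  "enumerates_connected d r G \<longleftrightarrow>
    (\<forall>i\<in>{1..r}. connected_upto d (G i)) \<and>
    (\<forall>i\<in>{1..r}. \<forall>j\<in>{1..r}. i \<noteq> j \<longrightarrow> \<not> isomorphic_core (G i) (G j)) \<and>
    (\<forall>H :: nat graph. connected_upto d H \<longrightarrow> (\<exists>i\<in>{1..r}. isomorphic_core H (G i)))"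

lemma isomorphic_refl: "isomorphic G G"
  unfolding isomorphic_def by (rule exI[of _ id]) auto

lemma isomorphic_trans:
  assumes "isomorphic G H" "isomorphic H K" shows "isomorphic G K"
proof -
  obtain f g where fg: "bij_betw f (verts G) (verts H)" "edges H = (\<lambda>e. f ` e) ` edges G"
    "bij_betw g (verts H) (verts K)" "edges K = (\<lambda>e. g ` e) ` edges H"
    using assms unfolding isomorphic_def by (elim exE conjE)
  have "bij_betw (g \<circ> f) (verts G) (verts K)" using fg(1,3) by (rule bij_betw_trans)
  moreover have "edges K = (\<lambda>e. (g \<circ> f) ` e) ` edges G"
    unfolding fg(2,4) by (simp add: image_image image_comp)
  ultimately show ?thesis unfolding isomorphic_def by (intro exI conjI)
qed

lemma isomorphic_core_iff:
  "isomorphic_core G H \<longleftrightarrow>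
    (\<exists>f. bij_betw f (\<Union>(edges G)) (\<Union>(edges H)) \<and> edges H = (\<lambda>e. f ` e) ` edges G)"
  by (simp only: isomorphic_core_def isomorphic_def drop_isolated_def edge_graph_def graph.sel)

lemma isomorphic_core_sym:
  assumes "isomorphic_core G H" shows "isomorphic_core H G"
proof -
  obtain f where f: "bij_betw f (\<Union>(edges G)) (\<Union>(edges H))" "edges H = (\<lambda>e. f ` e) ` edges G"
    using assms unfolding isomorphic_core_iff by (elim exE conjE)
  define g where "g = inv_into (\<Union>(edges G)) f"
  have g: "bij_betw g (\<Union>(edges H)) (\<Union>(edges G))"
    unfolding g_def using f(1) by (rule bij_betw_inv_into)
  have "g ` f ` e = e" if "e \<in> edges G" for e
    unfolding g_def using f(1) that
    by (intro inv_into_image_cancel Union_upper) (simp add: bij_betw_def)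
  then have "edges G = (\<lambda>e. g ` e) ` edges H" by (simp add: f(2) image_image)
  with g show ?thesis unfolding isomorphic_core_iff by (intro exI conjI)
qed

lemma finite_edges: "simple_graph G \<Longrightarrow> finite (edges G)"
  unfolding simple_graph_def by (rule finite_subset[of _ "Pow (verts G)"]) auto

lemma connected_upto_small:
  fixes H :: "nat graph"
  assumes "connected_upto d H"
  shows "\<exists>K. connected_upto d K \<and> verts K = \<Union>(edges K) \<and> verts K \<subseteq> {..<2*d} \<and> isomorphic_core H K"
proof -
  let ?V = "\<Union>(edges H)"
  have sH: "simple_graph H" and cH: "connected_graph H" and dH: "1 \<le> degree H" "degree H \<le> d"
    using assms by (auto simp: connected_upto_def)
  have finE: "finite (edges H)" using sH by (rule finite_edges)
  have two: "card e = 2" if "e \<in> edges H" for e using sH that by (simp add: simple_graph_def)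
  have finV: "finite ?V" using sH unfolding simple_graph_def by (meson Sup_least finite_subset)
  have "card ?V \<le> (\<Sum>e\<in>edges H. card e)" by (rule card_Union_le_sum_card)
  also have "\<dots> = 2 * degree H" using two by (simp add: degree_def)
  finally have cV: "card ?V \<le> 2 * d" using dH by linarith
  obtain f where f: "bij_betw f ?V {0..<card ?V}" using ex_bij_betw_finite_nat[OF finV] by blast
  define F where "F = (\<lambda>e. f ` e) ` edges H"
  define K where "K = Graph (\<Union>F) F"
  have UF: "\<Union>F = f ` ?V" unfolding F_def by blast
  have inj: "inj_on f ?V" using f by (simp add: bij_betw_def)
  have "card (f ` e) = 2" if "e \<in> edges H" for e
    using that two inj by (metis Sup_upper card_image inj_on_subset)
  then have "\<forall>e\<in>F. card e = 2" by (simp add: F_def)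
  moreover have "finite (\<Union>F)" using finV by (simp add: UF)
  ultimately have sK: "simple_graph K"
    by (simp add: simple_graph_def K_def Union_upper)
  have "inj_on (\<lambda>e. f ` e) (edges H)"
    by (rule inj_onI) (metis Sup_upper inj inj_on_image_eq_iff)
  then have dK: "degree K = degree H" by (simp add: degree_def K_def F_def card_image)
  have path: "(f u, f v) \<in> {(x, y). {x, y} \<in> F}\<^sup>*" if "(u, v) \<in> {(x, y). {x, y} \<in> edges H}\<^sup>*" for u v
    using that
  proof induction
    case (step y z)
    then have "f ` {y, z} \<in> F" unfolding F_def by blast
    then have "(f y, f z) \<in> {(x, y). {x, y} \<in> F}" by simp
    with step.IH show ?case by (rule rtrancl_into_rtrancl)
  qed simp
  have "(f u, f v) \<in> {(x, y). {x, y} \<in> F}\<^sup>*" if "u \<in> ?V" "v \<in> ?V" for u v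
  proof (rule path)
    have "verts (drop_isolated H) = ?V" by (simp add: drop_isolated_def edge_graph_def)
    then show "(u, v) \<in> {(x, y). {x, y} \<in> edges H}\<^sup>*"
      using cH that unfolding connected_graph_def by metis
  qed
  then have "\<forall>u\<in>\<Union>F. \<forall>v\<in>\<Union>F. (u, v) \<in> {(x, y). {x, y} \<in> F}\<^sup>*"
    unfolding UF by blast
  moreover have "F \<noteq> {}" using cH by (simp add: connected_graph_def F_def)
  ultimately have cK: "connected_graph K"
    by (simp add: connected_graph_def K_def drop_isolated_def edge_graph_def)
  have "bij_betw f ?V (\<Union>F)" using inj by (simp add: UF bij_betw_def)
  then have "isomorphic_core H K"
    unfolding isomorphic_core_iff K_def graph.sel F_def by (intro exI[of _ f] conjI refl)
  moreover have "verts K \<subseteq> {..<2*d}" using f cV by (auto simp: K_def UF bij_betw_def)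
  moreover have "verts K = \<Union>(edges K)" by (simp add: K_def)
  moreover have "connected_upto d K" using sK cK dK dH by (simp add: connected_upto_def)
  ultimately show ?thesis by blast
qed

lemma enumerates_connected_exists: "\<exists>r G. enumerates_connected d r G"
proof -
  define R where "R = {K. connected_upto d K \<and> verts K = \<Union>(edges K) \<and> verts K \<subseteq> {..<2*d}}"
  have "R \<subseteq> (\<lambda>(V, E). Graph V E) ` (Pow {..<2*d} \<times> Pow (Pow {..<2*d}))"
  proof
    fix K assume "K \<in> R"
    then have "(verts K, edges K) \<in> Pow {..<2*d} \<times> Pow (Pow {..<2*d})" by (auto simp: R_def)
    then show "K \<in> (\<lambda>(V, E). Graph V E) ` (Pow {..<2*d} \<times> Pow (Pow {..<2*d}))"
      by (intro image_eqI[of _ _ "(verts K, edges K)"]) auto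
  qed
  then have finR: "finite R" by (rule finite_subset) auto
  define h where "h (K :: nat graph) = (SOME L. L \<in> R \<and> isomorphic_core K L)" for K
  have core_refl: "isomorphic_core K K" for K :: "nat graph"
    by (simp add: isomorphic_core_def isomorphic_refl)
  have trans: "isomorphic_core A C" if "isomorphic_core A B" "isomorphic_core B C" for A B C :: "nat graph"
    using that unfolding isomorphic_core_def by (rule isomorphic_trans)
  have h: "h K \<in> R \<and> isomorphic_core K (h K)" if "K \<in> R" for K
    unfolding h_def by (rule someI[of _ K]) (simp add: that core_refl)
  have heq: "h A = h B" if "isomorphic_core A B" for A B
  proof -
    have "(\<lambda>L :: nat graph. L \<in> R \<and> isomorphic_core A L) = (\<lambda>L. L \<in> R \<and> isomorphic_core B L)"
    proof (intro ext conj_cong HOL.refl)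
      fix L :: "nat graph"
      show "isomorphic_core A L = isomorphic_core B L"
        by (rule iffI) (erule trans[OF isomorphic_core_sym[OF that]], erule trans[OF that])
    qed
    then show ?thesis by (simp add: h_def)
  qed
  obtain G where G: "bij_betw G {1..card (h ` R)} (h ` R)"
    using ex_bij_betw_nat_finite_1[of "h ` R"] finR by blast
  have Gim: "G ` {1..card (h ` R)} = h ` R" and Ginj: "inj_on G {1..card (h ` R)}"
    using G by (auto simp: bij_betw_def)
  have Gmem: "G i \<in> h ` R" if "i \<in> {1..card (h ` R)}" for i
    using imageI[OF that, of G] unfolding Gim .
  have uniq: "A = B" if AB: "A \<in> h ` R" "B \<in> h ` R" "isomorphic_core A B" for A B
  proof -
    obtain A' B' where *: "A' \<in> R" "A = h A'" "B' \<in> R" "B = h B'" using AB(1,2) by (elim imageE)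
    have A: "isomorphic_core A' A" and B: "isomorphic_core B' B" using h *(1,3) by (simp_all add: *(2,4))
    have "isomorphic_core A' B'" by (rule trans[OF trans[OF A AB(3)] isomorphic_core_sym[OF B]])
    then show ?thesis unfolding *(2,4) by (rule heq)
  qed
  have "enumerates_connected d (card (h ` R)) G"
    unfolding enumerates_connected_def
  proof (intro conjI ballI allI impI)
    fix i assume "i \<in> {1..card (h ` R)}"
    then have "G i \<in> h ` R" by (rule Gmem)
    then obtain K where "K \<in> R" "G i = h K" by (elim imageE)
    then have "G i \<in> R" using h by simp
    then show "connected_upto d (G i)" by (simp add: R_def)
  next
    fix i j assume ij: "i \<in> {1..card (h ` R)}" "j \<in> {1..card (h ` R)}" "i \<noteq> j"
    then have "G i \<noteq> G j" using inj_on_eq_iff[OF Ginj] by simp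
    moreover have "G i \<in> h ` R" "G j \<in> h ` R" using Gmem ij by blast+
    ultimately show "\<not> isomorphic_core (G i) (G j)" using uniq by metis
  next
    fix H :: "nat graph" assume "connected_upto d H"
    from connected_upto_small[OF this] obtain K where K: "K \<in> R" "isomorphic_core H K"
      by (auto simp: R_def)
    then have "isomorphic_core H (h K)" by (intro trans[OF K(2)] conjunct2[OF h[OF K(1)]])
    moreover have "h K \<in> G ` {1..card (h ` R)}" unfolding Gim using K(1) by (rule imageI)
    ultimately show "\<exists>i\<in>{1..card (h ` R)}. isomorphic_core H (G i)" by (elim imageE) (rule bexI, simp_all)
  qed
  then show ?thesis by (intro exI)
qed

end

theory Submission
  imports Defs
begin

text \<open>
  Let \<open>P\<close> be a path with \<open>d + 1\<close> edges, let \<open>X\<close> and \<open>Y\<close> be \<open>P\<close> without its last and without its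
  first edge, and let \<open>T\<close> be the disjoint sum of \<open>X \<union> Y = P\<close> and \<open>X \<inter> Y\<close>, and \<open>U\<close> that of \<open>X\<close> and
  \<open>Y\<close>. A connected subgraph of \<open>P\<close> containing both end edges is all of \<open>P\<close>, so every connected
  subgraph with at most \<open>d\<close> edges lies in \<open>X\<close> or in \<open>Y\<close>, and inclusion--exclusion shows that \<open>T\<close> and
  \<open>U\<close> contain the same number of copies of every connected graph with at most \<open>d\<close> edges. Only \<open>T\<close>
  contains a connected subgraph with \<open>d + 1\<close> edges. Both have \<open>2 d\<close> edges.
\<close>

section \<open>Connectedness of edge sets\<close>

text \<open>
  Connectedness as the absence of a separating vertex set: unlike the definition by walks, this is
  preserved under images by arbitrary vertex maps for trivial reasons.
\<close>

definition unseparated :: "'a set set \<Rightarrow> bool" where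
  "unseparated F \<longleftrightarrow> (\<forall>S. (\<forall>e\<in>F. e \<subseteq> S \<or> e \<inter> S = {}) \<longrightarrow> \<Union>F \<subseteq> S \<or> \<Union>F \<inter> S = {})"

lemma unseparatedD:
  assumes "unseparated F" "\<And>e. e \<in> F \<Longrightarrow> e \<subseteq> S \<or> e \<inter> S = {}"
  shows "\<Union>F \<subseteq> S \<or> \<Union>F \<inter> S = {}"
  using assms unfolding unseparated_def by blast

text \<open>Pull \<open>S\<close> back along \<open>f\<close>: an edge crossing the preimage would
  have an image crossing \<open>S\<close>.\<close>

lemma unseparated_image:
  assumes "unseparated F"
  shows "unseparated ((\<lambda>e. f ` e) ` F)"
  unfolding unseparated_def
proof (intro allI impI)
  fix S assume S: "\<forall>e\<in>(\<lambda>e. f ` e) ` F. e \<subseteq> S \<or> e \<inter> S = {}"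
  have "e \<subseteq> f -` S \<or> e \<inter> f -` S = {}" if "e \<in> F" for e
  proof -
    have "f ` e \<subseteq> S \<or> f ` e \<inter> S = {}" using bspec[OF S imageI[OF that]] .
    then show ?thesis by (auto simp: image_subset_iff disjoint_iff)
  qed
  from unseparatedD[OF assms this] have "\<Union>F \<subseteq> f -` S \<or> \<Union>F \<inter> f -` S = {}" .
  then have "f ` \<Union>F \<subseteq> S \<or> f ` \<Union>F \<inter> S = {}" by (auto simp: image_subset_iff disjoint_iff)
  then show "\<Union>((\<lambda>e. f ` e) ` F) \<subseteq> S \<or> \<Union>((\<lambda>e. f ` e) ` F) \<inter> S = {}"
    by (simp only: image_Union)
qed

text \<open>A walk cannot leave a vertex set that no edge crosses, so such a set contains all
  vertices as soon as it contains one.\<close>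

lemma connected_graph_unseparated:
  assumes "connected_graph H"
  shows "unseparated (edges H)"
  unfolding unseparated_def
proof (intro allI impI)
  fix S assume S: "\<forall>e\<in>edges H. e \<subseteq> S \<or> e \<inter> S = {}"
  have walk: "v \<in> S" if "(u, v) \<in> {(x, y). {x, y} \<in> edges H}\<^sup>*" "u \<in> S" for u v
    using that
  proof (induction rule: rtrancl_induct)
    case (step y z)
    have "{y, z} \<in> edges H" using step.hyps(2) by simp
    with S have "{y, z} \<subseteq> S \<or> {y, z} \<inter> S = {}" by (rule bspec)
    moreover have "y \<in> S" using step.IH step.prems by simp
    ultimately show ?case by simp
  qed
  have "(u, v) \<in> {(x, y). {x, y} \<in> edges H}\<^sup>*" if "u \<in> \<Union>(edges H)" "v \<in> \<Union>(edges H)" for u v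
    using assms that
    unfolding connected_graph_def drop_isolated_def edge_graph_def graph.sel by blast
  with walk show "\<Union>(edges H) \<subseteq> S \<or> \<Union>(edges H) \<inter> S = {}" by blast
qed

text \<open>No edge of \<open>F\<close> crosses the vertex set of \<open>A\<close>, so
  \<open>F\<close> lies inside it or avoids it. Getting back from vertices to edges uses that edges
  are nonempty: an empty edge would fit into either side.\<close>

lemma unseparated_Un:
  assumes "unseparated F" "F \<subseteq> A \<union> B" "\<Union>A \<inter> \<Union>B = {}" "{} \<notin> F"
  shows "F \<subseteq> A \<or> F \<subseteq> B"
proof -
  have "\<Union>F \<subseteq> \<Union>A \<or> \<Union>F \<inter> \<Union>A = {}"
  proof (rule unseparatedD[OF assms(1)])
    fix e assume "e \<in> F"
    then have "e \<in> A \<or> e \<in> B" using assms(2) by blast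
    then show "e \<subseteq> \<Union>A \<or> e \<inter> \<Union>A = {}" using assms(3) by blast
  qed
  then show ?thesis
  proof
    assume F: "\<Union>F \<subseteq> \<Union>A"
    have "e \<in> A" if "e \<in> F" for e
    proof (rule ccontr)
      assume "e \<notin> A"
      then have "e \<in> B" using assms(2) that by blast
      then have "e \<subseteq> \<Union>A \<inter> \<Union>B" using F that by blast
      then show False using assms(3,4) that by simp
    qed
    then show ?thesis by blast
  next
    assume F: "\<Union>F \<inter> \<Union>A = {}"
    have "e \<in> B" if "e \<in> F" for e
    proof (rule ccontr)
      assume "e \<notin> B"
      then have "e \<in> A" using assms(2) that by blast
      then have "e \<subseteq> \<Union>F \<inter> \<Union>A" using that by blast
      then show False using F assms(4) that by simp
    qed
    then show ?thesis by blast
  qed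
qed

section \<open>Counting copies of a connected graph\<close>

text \<open>The host is an edge set rather than a graph, so that unions, intersections and images of
  hosts can be formed directly.\<close>

definition copies :: "'a graph \<Rightarrow> 'b set set \<Rightarrow> 'b set set set" where
  "copies G E = {F. F \<subseteq> E \<and> isomorphic (drop_isolated G) (edge_graph F)}"

lemma subgraph_count_copies: "subgraph_count G H = card (copies G (edges H))"
  by (simp add: subgraph_count_def copies_def)

lemma finite_copies: "finite E \<Longrightarrow> finite (copies G E)"
  by (rule finite_subset[of _ "Pow E"]) (auto simp: copies_def)

lemma copies_Int: "copies G (A \<inter> B) = copies G A \<inter> copies G B"
  by (auto simp: copies_def)

text \<open>Forgets that the vertex map is bijective; being an image suffices to transfer
  connectedness, nonemptiness and the bound on the number of edges.\<close>

lemma copies_image_edges: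
  assumes "F \<in> copies G E"
  obtains f where "F = (\<lambda>e. f ` e) ` edges G"
  using assms
  by (auto simp: copies_def isomorphic_def drop_isolated_def edge_graph_def)

lemma copies_unseparated:
  assumes "connected_graph G" "F \<in> copies G E"
  shows "unseparated F"
  using assms by (metis copies_image_edges connected_graph_unseparated unseparated_image)

lemma copies_card_le:
  assumes "simple_graph G" "F \<in> copies G E"
  shows "card F \<le> degree G"
  using assms by (metis copies_image_edges card_image_le degree_def finite_edges)

lemma copies_nonempty:
  assumes "connected_graph G" "F \<in> copies G E"
  shows "F \<noteq> {}"
  using assms by (metis copies_image_edges connected_graph_def image_is_empty)

text \<open>Connectedness puts each copy into one summand. None lies in both, since copies are
  nonempty and the summands share no edge.\<close>

lemma card_copies_disjoint_Un:
  assumes G: "connected_graph G" and fin: "finite A" "finite B"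
    and disj: "\<Union>A \<inter> \<Union>B = {}" and ne: "{} \<notin> A \<union> B"
  shows "card (copies G (A \<union> B)) = card (copies G A) + card (copies G B)"
proof -
  have "copies G (A \<union> B) = copies G A \<union> copies G B"
  proof
    show "copies G (A \<union> B) \<subseteq> copies G A \<union> copies G B"
    proof
      fix F assume F: "F \<in> copies G (A \<union> B)"
      then have sub: "F \<subseteq> A \<union> B" by (simp add: copies_def)
      have "F \<subseteq> A \<or> F \<subseteq> B"
        using unseparated_Un[OF copies_unseparated[OF G F] sub disj] ne sub by blast
      with F show "F \<in> copies G A \<union> copies G B" by (auto simp: copies_def)
    qed
  qed (auto simp: copies_def)
  moreover have "copies G A \<inter> copies G B = {}"
  proof -
    have "A \<inter> B \<subseteq> {{}}" using disj by blast
    with ne have "A \<inter> B = {}" by blast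
    then have "copies G (A \<inter> B) = {}"
      using copies_nonempty[OF G] by (auto simp: copies_def)
    then show ?thesis by (simp add: copies_Int)
  qed
  ultimately show ?thesis using fin by (simp add: card_Un_disjoint finite_copies)
qed

lemma drop_isolated_edge_graph: "drop_isolated (edge_graph F) = edge_graph F"
  by (simp add: drop_isolated_def edge_graph_def)

text \<open>Symmetry is at hand for \<open>isomorphic_core\<close>; on graphs of the form
  \<open>edge_graph F\<close> it carries over to \<open>isomorphic\<close>, because dropping
  isolated vertices changes nothing there.\<close>

lemma isomorphic_edge_graph_image:
  assumes "inj f"
  shows "isomorphic H (edge_graph ((\<lambda>e. f ` e) ` F)) \<longleftrightarrow> isomorphic H (edge_graph F)"
proof -
  have "bij_betw f (\<Union>F) (\<Union>((\<lambda>e. f ` e) ` F))"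
    using assms by (auto simp: bij_betw_def intro: inj_on_subset)
  then have core: "isomorphic_core (edge_graph F) (edge_graph ((\<lambda>e. f ` e) ` F))"
    unfolding isomorphic_core_iff edge_graph_def graph.sel by blast
  then have "isomorphic (edge_graph F) (edge_graph ((\<lambda>e. f ` e) ` F))"
    "isomorphic (edge_graph ((\<lambda>e. f ` e) ` F)) (edge_graph F)"
    using isomorphic_core_sym[OF core] by (simp_all add: isomorphic_core_def drop_isolated_edge_graph)
  then show ?thesis by (blast intro: isomorphic_trans)
qed

lemma card_copies_image:
  assumes "inj f"
  shows "card (copies G ((\<lambda>e. f ` e) ` E)) = card (copies G E)"
proof -
  have "copies G ((\<lambda>e. f ` e) ` E) = (\<lambda>F. (\<lambda>e. f ` e) ` F) ` copies G E"
    by (auto simp: copies_def subset_image_iff isomorphic_edge_graph_image[OF assms])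
  moreover have "inj (\<lambda>F. (\<lambda>e. f ` e) ` F)"
    using assms by (intro inj_on_image) (auto intro: inj_on_subset)
  ultimately show ?thesis by (simp add: card_image inj_on_subset)
qed

text \<open>Inclusion-exclusion: \<open>cover\<close> says that the union creates no new copies, and
  the copies in the intersection are exactly the common ones.\<close>

lemma card_copies_Un_Int:
  assumes fin: "finite X" "finite Y"
    and cover: "\<And>F. F \<in> copies G (X \<union> Y) \<Longrightarrow> F \<subseteq> X \<or> F \<subseteq> Y"
  shows "card (copies G (X \<union> Y)) + card (copies G (X \<inter> Y)) =
    card (copies G X) + card (copies G Y)"
proof -
  have "copies G (X \<union> Y) = copies G X \<union> copies G Y"
    using cover by (auto simp: copies_def)
  then show ?thesis
    using card_Un_Int[of "copies G X" "copies G Y"] fin by (simp add: copies_Int finite_copies)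
qed

section \<open>Paths on the natural numbers\<close>

text \<open>Each edge is indexed by its left endpoint, so operations on edge sets become operations
  on index sets. The path \<open>path_edges {..n}\<close> has \<open>n + 1\<close> edges.\<close>

definition path_edges :: "nat set \<Rightarrow> nat set set" where
  "path_edges I = (\<lambda>i. {i, Suc i}) ` I"

lemma inj_path_edge: "inj (\<lambda>i. {i, Suc i})"
  by (rule injI) (auto simp: doubleton_eq_iff)

lemma finite_path_edges: "finite I \<Longrightarrow> finite (path_edges I)"
  by (simp add: path_edges_def)

lemma card_path_edges: "card (path_edges I) = card I"
  unfolding path_edges_def by (intro card_image inj_on_subset[OF inj_path_edge]) simp

lemma path_edges_Int: "path_edges (I \<inter> J) = path_edges I \<inter> path_edges J"
  unfolding path_edges_def by (rule image_Int[OF inj_path_edge])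

lemma path_edges_Un: "path_edges (I \<union> J) = path_edges I \<union> path_edges J"
  by (simp add: path_edges_def image_Un)

lemma path_edge_in_iff: "{i, Suc i} \<in> path_edges I \<longleftrightarrow> i \<in> I"
  unfolding path_edges_def by (rule inj_image_mem_iff[OF inj_path_edge])

lemma path_edges_shift: "path_edges ((+) n ` I) = (\<lambda>e. (+) n ` e) ` path_edges I"
  by (simp add: path_edges_def image_image)

lemma card_path_edge: "e \<in> path_edges I \<Longrightarrow> card e = 2"
  by (auto simp: path_edges_def)

lemma unseparated_path_edges: "unseparated (path_edges {..n})"
  unfolding unseparated_def
proof (intro allI impI)
  fix S assume S: "\<forall>e\<in>path_edges {..n}. e \<subseteq> S \<or> e \<inter> S = {}"
  have step: "Suc i \<in> S \<longleftrightarrow> i \<in> S" if "i \<le> n" for i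
    using S that by (auto simp: path_edges_def)
  have "i \<in> S \<longleftrightarrow> 0 \<in> S" if "i \<le> Suc n" for i
    using that by (induction i) (simp_all add: step)
  moreover have "\<Union>(path_edges {..n}) \<subseteq> {..Suc n}" by (auto simp: path_edges_def)
  ultimately show "\<Union>(path_edges {..n}) \<subseteq> S \<or> \<Union>(path_edges {..n}) \<inter> S = {}"
    by blast
qed

text \<open>If the edge at \<open>i\<close> were missing, no edge of \<open>F\<close> would cross
  \<open>{..i}\<close>, although \<open>0\<close> lies inside this set and \<open>Suc n\<close>
  outside.\<close>

lemma unseparated_subset_path_edges:
  assumes F: "unseparated F" "F \<subseteq> path_edges {..n}"
    and ends: "{0, Suc 0} \<in> F" "{n, Suc n} \<in> F"
  shows "F = path_edges {..n}"
proof -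
  have "{i, Suc i} \<in> F" if "i \<le> n" for i
  proof (rule ccontr)
    assume i: "{i, Suc i} \<notin> F"
    have "\<Union>F \<subseteq> {..i} \<or> \<Union>F \<inter> {..i} = {}"
    proof (rule unseparatedD[OF F(1)])
      fix e assume e: "e \<in> F"
      then obtain j where j: "e = {j, Suc j}" using F(2) by (auto simp: path_edges_def)
      have "j \<noteq> i" using e i j by blast
      then show "e \<subseteq> {..i} \<or> e \<inter> {..i} = {}" unfolding j by auto
    qed
    moreover have "0 \<in> \<Union>F" "Suc n \<in> \<Union>F" using ends by auto
    ultimately have "Suc n \<le> i" by auto
    with that show False by simp
  qed
  then show ?thesis using F(2) by (auto simp: path_edges_def)
qed

text \<open>With at most \<open>n\<close> of the \<open>n + 1\<close> edges, \<open>F\<close> is not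
  the whole path, so it misses one of the two end edges.\<close>

lemma unseparated_path_edges_small:
  assumes F: "unseparated F" "F \<subseteq> path_edges {..n}" "card F \<le> n"
  shows "F \<subseteq> path_edges {..<n} \<or> F \<subseteq> path_edges {1..n}"
proof -
  have "F \<noteq> path_edges {..n}" using F(3) by (auto simp: card_path_edges)
  then have "{0, Suc 0} \<notin> F \<or> {n, Suc n} \<notin> F"
    using unseparated_subset_path_edges[OF F(1,2)] by blast
  then show ?thesis
  proof
    assume *: "{0, Suc 0} \<notin> F"
    have "F \<subseteq> path_edges {1..n}"
    proof
      fix e assume e: "e \<in> F"
      then obtain j where j: "j \<le> n" "e = {j, Suc j}" using F(2) by (auto simp: path_edges_def)
      then have "j \<noteq> 0" using * e by metis
      with j show "e \<in> path_edges {1..n}" by (simp add: path_edge_in_iff)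
    qed
    then show ?thesis ..
  next
    assume *: "{n, Suc n} \<notin> F"
    have "F \<subseteq> path_edges {..<n}"
    proof
      fix e assume e: "e \<in> F"
      then obtain j where j: "j \<le> n" "e = {j, Suc j}" using F(2) by (auto simp: path_edges_def)
      then have "j \<noteq> n" using * e by metis
      with j show "e \<in> path_edges {..<n}" by (simp add: path_edge_in_iff)
    qed
    then show ?thesis ..
  qed
qed

lemma simple_path_edge_graph:
  assumes "finite I"
  shows "simple_graph (edge_graph (path_edges I))"
proof -
  have "finite (\<Union>(path_edges I))" using assms by (auto simp: path_edges_def)
  then show ?thesis
    by (auto simp: simple_graph_def edge_graph_def card_path_edge)
qed

section \<open>The two graphs and their comparison\<close>

theorem theorem20:
  fixes d r :: nat and G :: "nat \<Rightarrow> nat graph"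
  assumes "d \<ge> 1"
    and "enumerates_connected d r G"
  shows "\<exists>(T :: nat graph) (U :: nat graph).
    simple_graph T \<and> simple_graph U \<and>
    degree T \<le> (d + 1) * (2 ^ d - 1) \<and> degree U \<le> (d + 1) * (2 ^ d - 1) \<and>
    \<not> isomorphic_core T U \<and>
    (\<forall>i\<in>{1..r}. subgraph_count (G i) T = subgraph_count (G i) U)"
proof -
  \<comment> \<open>The unshifted summands have vertices at most \<open>d + 1\<close>, so a shift by
    \<open>d + 3\<close> makes the sums disjoint.\<close>
  define s where "s = (+) (d + 3)"
  have inj_s: "inj s" by (simp add: s_def)
  define X Y where "X = {..<d}" and "Y = {1..d}"
  have XY: "X \<union> Y = {..d}" "X \<inter> Y = {1..<d}" using assms(1) by (auto simp: X_def Y_def)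
  have fin: "finite X" "finite Y" by (simp_all add: X_def Y_def)
  define T where "T = edge_graph (path_edges ((X \<union> Y) \<union> s ` (X \<inter> Y)))"
  define U where "U = edge_graph (path_edges (X \<union> s ` Y))"
  have edges: "edges T = path_edges (X \<union> Y) \<union> path_edges (s ` (X \<inter> Y))"
    "edges U = path_edges X \<union> path_edges (s ` Y)"
    by (simp_all add: T_def U_def edge_graph_def path_edges_Un)
  have disjoint: "\<Union>(path_edges I) \<inter> \<Union>(path_edges (s ` J)) = {}" if "I \<subseteq> {..d}" for I J
  proof -
    have "\<Union>(path_edges I) \<subseteq> {..Suc d}" using that by (auto simp: path_edges_def)
    moreover have "\<Union>(path_edges (s ` J)) \<subseteq> {d + 3..}" by (auto simp: path_edges_def s_def)
    ultimately show ?thesis by fastforce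
  qed
  have disjT: "\<Union>(path_edges (X \<union> Y)) \<inter> \<Union>(path_edges (s ` (X \<inter> Y))) = {}"
    and disjU: "\<Union>(path_edges X) \<inter> \<Union>(path_edges (s ` Y)) = {}"
    by (rule disjoint, use XY(1) in blast)+
  have ne: "{} \<notin> path_edges I" for I by (auto simp: path_edges_def)
  have shift: "path_edges (s ` I) = (\<lambda>e. s ` e) ` path_edges I" for I
    unfolding s_def by (rule path_edges_shift)
  have simple: "simple_graph T" "simple_graph U"
    unfolding T_def U_def using fin by (auto intro!: simple_path_edge_graph)
  have card_s: "card (s ` I) = card I" for I
    by (intro card_image inj_on_subset[OF inj_s]) simp
  \<comment> \<open>Equality holds for \<open>d = 1\<close>; from \<open>d = 2\<close> on, the
    factor \<open>2 ^ d - 1\<close> is at least 3.\<close>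
  have bound: "d + d \<le> (d + 1) * (2 ^ d - 1)"
  proof (cases "d = 1")
    case False
    then have "(2::nat) ^ 2 \<le> 2 ^ d" using assms(1) by (intro power_increasing) auto
    then have "(d + 1) * 3 \<le> (d + 1) * (2 ^ d - 1)" by (intro mult_left_mono) auto
    then show ?thesis by simp
  qed simp
  have "degree T \<le> card (path_edges (X \<union> Y)) + card (path_edges (s ` (X \<inter> Y)))"
    unfolding degree_def edges by (rule card_Un_le)
  also have "\<dots> = d + d" using assms(1) unfolding card_path_edges card_s XY by simp
  finally have degT: "degree T \<le> (d + 1) * (2 ^ d - 1)" using bound by linarith
  have "degree U \<le> card (path_edges X) + card (path_edges (s ` Y))"
    unfolding degree_def edges by (rule card_Un_le)
  also have "\<dots> = d + d" unfolding card_path_edges card_s by (simp add: X_def Y_def)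
  finally have degU: "degree U \<le> (d + 1) * (2 ^ d - 1)" using bound by linarith
  have "\<not> isomorphic_core T U"
  proof
    assume "isomorphic_core T U"
    then obtain f where f: "bij_betw f (\<Union>(edges T)) (\<Union>(edges U))"
      "edges U = (\<lambda>e. f ` e) ` edges T"
      unfolding isomorphic_core_iff by blast
    \<comment> \<open>The image in \<open>U\<close> of the long path of \<open>T\<close> is
      connected with \<open>d + 1\<close> edges, but each of the two summands of \<open>U\<close>
      has only \<open>d\<close>.\<close>
    let ?P = "path_edges {..d}"
    let ?F = "(\<lambda>e. f ` e) ` ?P"
    have PT: "?P \<subseteq> edges T" using XY(1) edges(1) by auto
    \<comment> \<open>The map \<open>f\<close> is known to be injective only on the non-isolated
      vertices of \<open>T\<close>, which contain every edge of the path.\<close>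
    have "inj_on (\<lambda>e. f ` e) ?P"
    proof (rule inj_onI)
      fix a b assume ab: "a \<in> ?P" "b \<in> ?P" "f ` a = f ` b"
      then have "a \<subseteq> \<Union>(edges T)" "b \<subseteq> \<Union>(edges T)" using PT by blast+
      with ab(3) show "a = b"
        using inj_on_image_eq_iff[OF bij_betw_imp_inj_on[OF f(1)]] by blast
    qed
    then have card_F: "card ?F = Suc d" by (simp add: card_image card_path_edges)
    have "?F \<subseteq> edges U" using PT f(2) by blast
    moreover have "{} \<notin> ?F" using ne[of "{..d}"] by auto
    ultimately have "?F \<subseteq> path_edges X \<or> ?F \<subseteq> path_edges (s ` Y)"
      unfolding edges
      by (intro unseparated_Un[OF unseparated_image[OF unseparated_path_edges] _ disjU])
    moreover have "card (path_edges X) = d" "card (path_edges (s ` Y)) = d"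
      unfolding card_path_edges card_s by (simp_all add: X_def Y_def)
    moreover have "finite (path_edges X)" "finite (path_edges (s ` Y))"
      using fin by (simp_all add: finite_path_edges)
    ultimately have "card ?F \<le> d" by (metis card_mono)
    with card_F show False by simp
  qed
  moreover have "subgraph_count (G i) T = subgraph_count (G i) U" if "i \<in> {1..r}" for i
  proof -
    have "connected_upto d (G i)" using assms(2) that by (simp add: enumerates_connected_def)
    then have Gi: "simple_graph (G i)" "connected_graph (G i)" "degree (G i) \<le> d"
      by (simp_all add: connected_upto_def)
    let ?c = "\<lambda>I. card (copies (G i) (path_edges I))"
    have c_s: "?c (s ` I) = ?c I" for I
      unfolding shift by (rule card_copies_image[OF inj_s])
    have "subgraph_count (G i) T = ?c (X \<union> Y) + ?c (s ` (X \<inter> Y))"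
      unfolding subgraph_count_copies edges using fin ne
      by (intro card_copies_disjoint_Un[OF Gi(2) _ _ disjT]) (simp_all add: finite_path_edges)
    also have "\<dots> = ?c (X \<union> Y) + ?c (X \<inter> Y)" by (simp only: c_s)
    \<comment> \<open>The heart of the count: a copy of \<open>G i\<close> has at most
      \<open>d\<close> edges, so inside the path it misses an end edge and lies in \<open>X\<close>
      or in \<open>Y\<close>.\<close>
    also have "\<dots> = ?c X + ?c Y"
      unfolding path_edges_Un path_edges_Int
    proof (rule card_copies_Un_Int)
      fix F assume F: "F \<in> copies (G i) (path_edges X \<union> path_edges Y)"
      then have sub: "F \<subseteq> path_edges {..d}"
        unfolding XY(1)[symmetric] path_edges_Un by (simp add: copies_def)
      have "card F \<le> d" using copies_card_le[OF Gi(1) F] Gi(3) by linarith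
      then show "F \<subseteq> path_edges X \<or> F \<subseteq> path_edges Y"
        unfolding X_def Y_def
        by (rule unseparated_path_edges_small[OF copies_unseparated[OF Gi(2) F] sub])
    qed (use fin in \<open>simp_all add: finite_path_edges\<close>)
    also have "\<dots> = ?c X + ?c (s ` Y)" by (simp only: c_s)
    also have "\<dots> = subgraph_count (G i) U"
      unfolding subgraph_count_copies edges using fin ne
      by (intro card_copies_disjoint_Un[OF Gi(2) _ _ disjU, symmetric])
        (simp_all add: finite_path_edges)
    finally show ?thesis .
  qed
  ultimately show ?thesis using simple degT degU by blast
qed

end
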